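(* Assume that the unperturbed system $\dot x=X^0(x)$ on $\mathscr{M}$ has a $T$-periodic orbit $\gamma(t)$ for some constant $T>0$, and that it has a non-constant $C^3$ first integral $F(x)$ (i.e. $dF(X^0)=0$) near $\Gamma=\{\gamma(t)\mid t\in[0,T)\}$. If the perturbed system $\dot x=X_\varepsilon(x)$ has a $C^3$ first integral $F_\varepsilon(x)$ (i.e. $dF_\varepsilon(X_\varepsilon)=0$) depending $C^2$-smoothly on $\varepsilon$ near $\Gamma$ such that $F_0(x)=F(x)$, then $$\mathscr{I}_{F,\gamma}:=\int_0^T dF(X^1)(\gamma(t))\,dt=0 .$$
   Context: $\mathscr{M}$ is an $n$-dimensional ($n\ge 2$) paracompact oriented $C^3$ real manifold. $\varepsilon$ is a small parameter, $0\le\varepsilon\ll 1$, and $X_\varepsilon$ is a family of vector fields on $\mathscr{M}$ that is $C^2$ with respect to $x$ and $\varepsilon$, with $X_\varepsilon(x)=X^0(x)+\varepsilon X^1(x)+O(\varepsilon^2)$. "Near $\Gamma$" means on some neighborhood (independent of $\varepsilon$) of $\Gamma$ in $\mathscr{M}$. *)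

theory Defs
  imports "HOL-Analysis.Analysis" "HOL-Library.Landau_Symbols"
begin

section \<open>Functions of class \<open>C\<^sup>k\<close>\<close>

text \<open>
  The derivatives are taken within \<open>S\<close>.  For open \<open>S\<close> this is the usual notion; for
  \<open>S = U \<times> {0..<e}\<close> with \<open>U\<close> open it means that all partial derivatives up to order \<open>k\<close> exist,
  one-sided ones at parameter value \<open>0\<close>, and are continuous on \<open>S\<close>.  In both cases
  the derivative within \<open>S\<close> is unique, so that the existential quantifier is harmless.
\<close>

primrec Ck_on :: "nat \<Rightarrow> 'a::real_normed_vector set \<Rightarrow> ('a \<Rightarrow> 'b::real_normed_vector) \<Rightarrow> bool" where
  "Ck_on 0 S f \<longleftrightarrow> continuous_on S f"
| "Ck_on (Suc k) S f \<longleftrightarrow>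
     (\<exists>f'. (\<forall>x\<in>S. (f has_derivative f' x) (at x within S)) \<and> (\<forall>v. Ck_on k S (\<lambda>x. f' x v)))"


section \<open>Oriented manifolds\<close>

text \<open>
  A chart is a domain together with a coordinate map, whose values outside the domain are
  irrelevant.
\<close>

type_synonym ('m, 'n) chart = "'m set \<times> ('m \<Rightarrow> real ^ 'n)"

abbreviation chart_dom :: "('m, 'n) chart \<Rightarrow> 'm set" where
  "chart_dom \<equiv> fst"

abbreviation chart_map :: "('m, 'n) chart \<Rightarrow> 'm \<Rightarrow> real ^ 'n" where
  "chart_map \<equiv> snd"

definition chart_inv :: "('m, 'n) chart \<Rightarrow> real ^ 'n \<Rightarrow> 'm" where
  "chart_inv c = inv_into (chart_dom c) (chart_map c)"

definition transition :: "('m, 'n) chart \<Rightarrow> ('m, 'n) chart \<Rightarrow> real ^ 'n \<Rightarrow> real ^ 'n" where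
  "transition c d = chart_map d \<circ> chart_inv c"

definition is_chart :: "'m topology \<Rightarrow> ('m, 'n::finite) chart \<Rightarrow> bool" where
  "is_chart M c \<longleftrightarrow> openin M (chart_dom c) \<and> open (chart_map c ` chart_dom c) \<and>
     homeomorphic_map (subtopology M (chart_dom c)) (top_of_set (chart_map c ` chart_dom c))
       (chart_map c)"

definition Ck_atlas :: "nat \<Rightarrow> 'm topology \<Rightarrow> ('m, 'n::finite) chart set \<Rightarrow> bool" where
  "Ck_atlas k M A \<longleftrightarrow> (\<forall>c\<in>A. is_chart M c) \<and> (\<Union>c\<in>A. chart_dom c) = topspace M \<and>
     (\<forall>c\<in>A. \<forall>d\<in>A. Ck_on k (chart_map c ` (chart_dom c \<inter> chart_dom d)) (transition c d))"

definition oriented_atlas :: "('m, 'n::finite) chart set \<Rightarrow> bool" where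
  "oriented_atlas A \<longleftrightarrow> (\<forall>c\<in>A. \<forall>d\<in>A. \<forall>x\<in>chart_map c ` (chart_dom c \<inter> chart_dom d).
     det (matrix (frechet_derivative (transition c d) (at x))) > 0)"

definition paracompact_space :: "'m topology \<Rightarrow> bool" where
  "paracompact_space M \<longleftrightarrow>
     (\<forall>\<U>. (\<forall>U\<in>\<U>. openin M U) \<and> \<Union>\<U> = topspace M \<longrightarrow>
       (\<exists>\<V>. (\<forall>V\<in>\<V>. openin M V \<and> (\<exists>U\<in>\<U>. V \<subseteq> U)) \<and> \<Union>\<V> = topspace M \<and>
            locally_finite_in M \<V>))"

text \<open>
  The atlas \<open>A\<close> need not be maximal: it determines the differentiable structure and the
  orientation, and the dimension is \<open>CARD('n)\<close>.
\<close>

definition oriented_Ck_manifold :: "nat \<Rightarrow> 'm topology \<Rightarrow> ('m, 'n::finite) chart set \<Rightarrow> bool" where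
  "oriented_Ck_manifold k M A \<longleftrightarrow>
     Hausdorff_space M \<and> paracompact_space M \<and> Ck_atlas k M A \<and> oriented_atlas A"


section \<open>Tangent vectors, vector fields and differentials\<close>

text \<open>
  A tangent vector at \<open>p\<close> is the family of its coordinate vectors in all charts around \<open>p\<close>,
  related by the derivatives of the transition maps.  (Derivations are unsuitable here: on a
  manifold of finite differentiability class they form an infinite-dimensional space.)  The value
  \<open>0\<close> at charts not containing \<open>p\<close> makes the representation unique.
\<close>

type_synonym ('m, 'n) tangent = "('m, 'n) chart \<Rightarrow> real ^ 'n"

definition charts_at :: "('m, 'n) chart set \<Rightarrow> 'm \<Rightarrow> ('m, 'n) chart set" where
  "charts_at A p = {c \<in> A. p \<in> chart_dom c}"

definition tangent_space :: "('m, 'n::finite) chart set \<Rightarrow> 'm \<Rightarrow> ('m, 'n) tangent set" where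
  "tangent_space A p = {v. (\<forall>c. c \<notin> charts_at A p \<longrightarrow> v c = 0) \<and>
     (\<forall>c\<in>charts_at A p. \<forall>d\<in>charts_at A p.
        v d = frechet_derivative (transition c d) (at (chart_map c p)) (v c))}"

definition vector_field ::
  "'m topology \<Rightarrow> ('m, 'n::finite) chart set \<Rightarrow> ('m \<Rightarrow> ('m, 'n) tangent) \<Rightarrow> bool" where
  "vector_field M A X \<longleftrightarrow> (\<forall>p\<in>topspace M. X p \<in> tangent_space A p)"

text \<open>The family \<open>X\<close> is \<open>C\<^sup>k\<close> jointly in the point and the parameter, which ranges over \<open>I\<close>.\<close>

definition Ck_vector_field_family ::
  "nat \<Rightarrow> 'm topology \<Rightarrow> ('m, 'n::finite) chart set \<Rightarrow> real set \<Rightarrow>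
     (real \<Rightarrow> 'm \<Rightarrow> ('m, 'n) tangent) \<Rightarrow> bool" where
  "Ck_vector_field_family k M A I X \<longleftrightarrow> (\<forall>\<epsilon>\<in>I. vector_field M A (X \<epsilon>)) \<and>
     (\<forall>c\<in>A. Ck_on k ((chart_map c ` chart_dom c) \<times> I) (\<lambda>(x, \<epsilon>). X \<epsilon> (chart_inv c x) c))"

definition Ck_function ::
  "nat \<Rightarrow> ('m, 'n::finite) chart set \<Rightarrow> 'm set \<Rightarrow> ('m \<Rightarrow> real) \<Rightarrow> bool" where
  "Ck_function k A W F \<longleftrightarrow>
     (\<forall>c\<in>A. Ck_on k (chart_map c ` (chart_dom c \<inter> W)) (F \<circ> chart_inv c))"

definition Ck_function_family ::
  "nat \<Rightarrow> ('m, 'n::finite) chart set \<Rightarrow> 'm set \<Rightarrow> real set \<Rightarrow> (real \<Rightarrow> 'm \<Rightarrow> real) \<Rightarrow> bool" where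
  "Ck_function_family k A W I F \<longleftrightarrow>
     (\<forall>c\<in>A. Ck_on k ((chart_map c ` (chart_dom c \<inter> W)) \<times> I) (\<lambda>(x, \<epsilon>). F \<epsilon> (chart_inv c x)))"

definition differential ::
  "('m, 'n::finite) chart set \<Rightarrow> ('m \<Rightarrow> real) \<Rightarrow> 'm \<Rightarrow> ('m, 'n) tangent \<Rightarrow> real" where
  "differential A F p v =
     (let c = (SOME c. c \<in> charts_at A p)
      in frechet_derivative (F \<circ> chart_inv c) (at (chart_map c p)) (v c))"

definition first_integral ::
  "nat \<Rightarrow> ('m, 'n::finite) chart set \<Rightarrow> 'm set \<Rightarrow> ('m \<Rightarrow> ('m, 'n) tangent) \<Rightarrow> ('m \<Rightarrow> real) \<Rightarrow> bool" where
  "first_integral k A W X F \<longleftrightarrow> Ck_function k A W F \<and> (\<forall>p\<in>W. differential A F p (X p) = 0)"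

definition integral_curve ::
  "'m topology \<Rightarrow> ('m, 'n::finite) chart set \<Rightarrow> ('m \<Rightarrow> ('m, 'n) tangent) \<Rightarrow> (real \<Rightarrow> 'm) \<Rightarrow> bool" where
  "integral_curve M A X \<gamma> \<longleftrightarrow> continuous_map euclideanreal M \<gamma> \<and>
     (\<forall>t. \<forall>c\<in>charts_at A (\<gamma> t).
        ((chart_map c \<circ> \<gamma>) has_vector_derivative X (\<gamma> t) c) (at t))"

definition first_order_expansion ::
  "'m topology \<Rightarrow> ('m, 'n::finite) chart set \<Rightarrow> (real \<Rightarrow> 'm \<Rightarrow> ('m, 'n) tangent) \<Rightarrow>
     ('m \<Rightarrow> ('m, 'n) tangent) \<Rightarrow> ('m \<Rightarrow> ('m, 'n) tangent) \<Rightarrow> bool" where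
  "first_order_expansion M A X X0 X1 \<longleftrightarrow>
     (\<forall>p\<in>topspace M. \<forall>c\<in>charts_at A p.
        (\<lambda>\<epsilon>. norm (X \<epsilon> p c - (X0 p c + \<epsilon> *\<^sub>R X1 p c))) \<in> O[at_right 0](\<lambda>\<epsilon>. \<epsilon>\<^sup>2))"


section \<open>The differential does not depend on the chart\<close>

lemma chart_inv_map:
  assumes "is_chart M c" "p \<in> chart_dom c"
  shows "chart_inv c (chart_map c p) = p"
proof -
  have "openin M (chart_dom c)"
    and h: "homeomorphic_map (subtopology M (chart_dom c)) (top_of_set (chart_map c ` chart_dom c))
      (chart_map c)"
    using assms(1) by (simp_all only: is_chart_def)
  then have "topspace (subtopology M (chart_dom c)) = chart_dom c"
    by (simp only: topspace_subtopology_subset openin_subset)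
  then have "inj_on (chart_map c) (chart_dom c)"
    using homeomorphic_imp_injective_map[OF h] by (simp only:)
  then show ?thesis
    using assms(2) by (simp add: chart_inv_def)
qed

lemma open_chart_image:
  assumes "is_chart M c" "openin M W"
  shows "open (chart_map c ` (chart_dom c \<inter> W))"
proof -
  have "open_map (subtopology M (chart_dom c)) (top_of_set (chart_map c ` chart_dom c)) (chart_map c)"
    using assms(1) by (simp only: is_chart_def homeomorphic_imp_open_map)
  moreover have "openin (subtopology M (chart_dom c)) (chart_dom c \<inter> W)"
    using assms(2) by (simp add: openin_subtopology_Int2)
  ultimately have "openin (top_of_set (chart_map c ` chart_dom c)) (chart_map c ` (chart_dom c \<inter> W))"
    by (simp only: open_map_def)
  then show ?thesis
    using assms(1) by (simp only: is_chart_def openin_open_eq)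
qed

lemma Ck_on_Suc_differentiable:
  assumes "Ck_on (Suc k) S f" "open S" "x \<in> S"
  shows "f differentiable (at x)"
proof -
  obtain f' where "(f has_derivative f' x) (at x within S)"
    using assms by auto
  then show ?thesis
    using assms(2,3) at_within_open[of x S] by (auto simp: differentiable_def)
qed

lemma differential_chart:
  assumes A: "Ck_atlas (Suc k) M A" and W: "openin M W" and F: "Ck_function (Suc l) A W F"
    and p: "p \<in> W" and v: "v \<in> tangent_space A p" and c: "c \<in> charts_at A p"
  shows "differential A F p v = frechet_derivative (F \<circ> chart_inv c) (at (chart_map c p)) (v c)"
proof -
  define d where "d = (SOME d. d \<in> charts_at A p)"
  have d: "d \<in> charts_at A p"
    unfolding d_def using c by (rule someI)
  have cd: "c \<in> A" "d \<in> A" "p \<in> chart_dom c" "p \<in> chart_dom d"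
    using c d by (auto simp: charts_at_def)
  have ch: "is_chart M c" "is_chart M d"
    using A cd by (simp_all only: Ck_atlas_def)
  let ?x = "chart_map c p" and ?y = "chart_map d p"
  define S where "S = chart_map d ` (chart_dom d \<inter> chart_dom c)"
  have S: "open S" "?y \<in> S"
  proof -
    have "openin M (chart_dom c)"
      using ch(1) by (simp only: is_chart_def)
    then show "open S"
      unfolding S_def by (rule open_chart_image[OF ch(2)])
    show "?y \<in> S"
      unfolding S_def using cd by blast
  qed
  have t_diff: "transition d c differentiable (at ?y)"
  proof (rule Ck_on_Suc_differentiable[OF _ S])
    show "Ck_on (Suc k) S (transition d c)"
      using A cd by (simp only: Ck_atlas_def S_def)
  qed
  have ty: "transition d c ?y = ?x"
    by (simp add: transition_def chart_inv_map[OF ch(2) cd(4)])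
  have Fc_diff: "(F \<circ> chart_inv c) differentiable (at ?x)"
  proof (rule Ck_on_Suc_differentiable)
    show "Ck_on (Suc l) (chart_map c ` (chart_dom c \<inter> W)) (F \<circ> chart_inv c)"
      using F cd by (simp only: Ck_function_def)
    show "open (chart_map c ` (chart_dom c \<inter> W))"
      by (rule open_chart_image[OF ch(1) W])
    show "?x \<in> chart_map c ` (chart_dom c \<inter> W)"
      using cd p by blast
  qed
  have chain: "((F \<circ> chart_inv c) \<circ> transition d c has_derivative
      frechet_derivative (F \<circ> chart_inv c) (at ?x) \<circ> frechet_derivative (transition d c) (at ?y)) (at ?y)"
  proof (rule diff_chain_at)
    show "(transition d c has_derivative frechet_derivative (transition d c) (at ?y)) (at ?y)"
      using t_diff by (simp only: frechet_derivative_works)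
    show "(F \<circ> chart_inv c has_derivative frechet_derivative (F \<circ> chart_inv c) (at ?x))
        (at (transition d c ?y))"
      unfolding ty using Fc_diff by (simp only: frechet_derivative_works)
  qed
  have "(F \<circ> chart_inv d has_derivative
      frechet_derivative (F \<circ> chart_inv c) (at ?x) \<circ> frechet_derivative (transition d c) (at ?y)) (at ?y)"
  proof (rule has_derivative_transform_within_open[OF chain S])
    fix y assume "y \<in> S"
    then obtain q where "q \<in> chart_dom d" "q \<in> chart_dom c" "y = chart_map d q"
      by (auto simp: S_def)
    then show "((F \<circ> chart_inv c) \<circ> transition d c) y = (F \<circ> chart_inv d) y"
      by (simp add: transition_def chart_inv_map[OF ch(1)] chart_inv_map[OF ch(2)])
  qed
  then have "frechet_derivative (F \<circ> chart_inv d) (at ?y) =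
      frechet_derivative (F \<circ> chart_inv c) (at ?x) \<circ> frechet_derivative (transition d c) (at ?y)"
    by (rule frechet_derivative_at[symmetric])
  moreover have "v c = frechet_derivative (transition d c) (at ?y) (v d)"
    using v c d unfolding tangent_space_def by blast
  ultimately show ?thesis
    by (simp only: differential_def Let_def d_def[symmetric] o_apply)
qed

end

theory Submission
  imports Defs
begin

text \<open>
  Why the integral vanishes.  For each parameter \<open>\<epsilon>\<close> the function \<open>F\<^sub>\<epsilon>\<close> takes equal values at the two
  ends of the closed orbit \<open>\<gamma>\<close>, so its derivative along \<open>\<gamma>\<close>, which is \<open>dF\<^sub>\<epsilon>(X\<^sup>0)\<close>, has integral zero over
  a period.  Since \<open>F\<^sub>\<epsilon>\<close> is a first integral of \<open>X\<^sub>\<epsilon>\<close>, this derivative equals \<open>- dF\<^sub>\<epsilon>(X\<^sub>\<epsilon> - X\<^sup>0)\<close>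
  (lemma \<open>first_integral_differential_difference\<close>).  Dividing by \<open>\<epsilon>\<close> gives integrands that still have
  integral zero and that converge pointwise to \<open>- dF(X\<^sup>1)\<close> as \<open>\<epsilon>\<close> tends to zero
  (\<open>first_integral_family_quotient\<close>).

  To interchange limit and integral, it suffices to bound these integrands by one constant.  Near each
  point of the orbit such a bound follows in a chart from the joint smoothness of the two families
  (\<open>first_integral_family_locally_linear_bound\<close>), and compactness of the period interval makes it uniform
  (\<open>compact_uniform_parameter_bound\<close>).  Dominated convergence then gives the claim.

  Differentiating \<open>dF\<^sub>\<epsilon>(X\<^sub>\<epsilon>) = 0\<close> at \<open>\<epsilon> = 0\<close> pointwise would call for the symmetry of a mixed second derivative
  at a boundary point of the parameter range; integrating along the orbit before taking the limit avoids
  this exchange.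
\<close>

section \<open>Functions with a one-sided parameter\<close>

lemma Ck_on_imp_continuous_on:
  assumes "Ck_on k S f"
  shows "continuous_on S f"
proof (cases k)
  case 0
  with assms show ?thesis by simp
next
  case (Suc l)
  with assms obtain f' where "\<forall>x\<in>S. (f has_derivative f' x) (at x within S)"
    by auto
  then show ?thesis
    using has_derivative_continuous_on by blast
qed

lemma Ck_on_SucE:
  assumes "Ck_on (Suc k) S f"
  obtains f' where "\<And>z. z \<in> S \<Longrightarrow> (f has_derivative f' z) (at z within S)"
    and "\<And>v. continuous_on S (\<lambda>z. f' z v)"
  using assms Ck_on_imp_continuous_on by (metis Ck_on.simps(2))

lemma at_within_Ico_at_right:
  fixes a b :: real
  assumes "a < b"
  shows "at a within {a..<b} = at_right a"
  by (rule at_within_nhd[where S = "{..<b}"]) (use assms in auto)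

text \<open>
  Derivatives of a family are taken within \<open>U \<times> {0..<e0}\<close>, which is not open; the derivative in the
  point alone is nevertheless two-sided, as a differential on the manifold has to be.
\<close>

lemma has_derivative_fst_slice:
  assumes f: "(f has_derivative f') (at (x, e) within U \<times> I)"
    and U: "open U" "x \<in> U" and e: "e \<in> I"
  shows "((\<lambda>x. f (x, e)) has_derivative (\<lambda>h. f' (h, 0))) (at x)"
proof -
  have "((\<lambda>x. (x, e)) has_derivative (\<lambda>h. (h, 0))) (at x within U)"
    by (intro has_derivative_Pair has_derivative_ident has_derivative_const)
  moreover have "(f has_derivative f') (at (x, e) within (\<lambda>x. (x, e)) ` U)"
    by (rule has_derivative_subset[OF f]) (use e in auto)
  ultimately have "((\<lambda>x. f (x, e)) has_derivative (\<lambda>h. f' (h, 0))) (at x within U)"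
    by (rule has_derivative_in_compose)
  then show ?thesis
    unfolding at_within_open[OF U(2,1)] .
qed

lemma has_derivative_snd_slice:
  fixes f :: "'a::real_normed_vector \<times> real \<Rightarrow> 'b::real_normed_vector"
  assumes f: "(f has_derivative f') (at (x, e) within U \<times> I)" and x: "x \<in> U"
  shows "((\<lambda>e. f (x, e)) has_derivative (\<lambda>h. h *\<^sub>R f' (0, 1))) (at e within I)"
proof -
  interpret bounded_linear f'
    using f by (rule has_derivative_bounded_linear)
  have "((\<lambda>e. (x, e)) has_derivative (\<lambda>h. (0, h))) (at e within I)"
    by (intro has_derivative_Pair has_derivative_ident has_derivative_const)
  moreover have "(f has_derivative f') (at (x, e) within (\<lambda>e. (x, e)) ` I)"
    by (rule has_derivative_subset[OF f]) (use x in auto)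
  ultimately have "((\<lambda>e. f (x, e)) has_derivative (\<lambda>h. f' (0, h))) (at e within I)"
    by (rule has_derivative_in_compose)
  moreover have "(\<lambda>h. f' (0, h)) = (\<lambda>h. h *\<^sub>R f' (0, 1))"
  proof
    fix h
    have "f' (0, h) = f' (h *\<^sub>R (0, 1))"
      by simp
    also have "\<dots> = h *\<^sub>R f' (0, 1)"
      by (rule scaleR)
    finally show "f' (0, h) = h *\<^sub>R f' (0, 1)" .
  qed
  ultimately show ?thesis
    by (rule back_subst)
qed

text \<open>
  The same radius bounds the point and the parameter, so that the estimates obtained for different
  functions can be combined by taking the minimum of their radii.
\<close>

lemma continuous_on_imp_locally_bounded:
  fixes g :: "'a::metric_space \<times> real \<Rightarrow> 'b::real_normed_vector"
  assumes g: "continuous_on (U \<times> {0..<e0}) g" and U: "open U" "x0 \<in> U" and e0: "e0 > 0"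
  obtains C d where "C \<ge> 0" "0 < d" "d \<le> e0" "ball x0 d \<subseteq> U"
    and "\<And>x e. x \<in> ball x0 d \<Longrightarrow> e \<in> {0..<d} \<Longrightarrow> norm (g (x, e)) \<le> C"
proof -
  obtain r where r: "r > 0" "ball x0 r \<subseteq> U"
    using U openE by blast
  obtain s where s: "s > 0"
    "\<And>z. z \<in> U \<times> {0..<e0} \<Longrightarrow> dist z (x0, 0) < s \<Longrightarrow> dist (g z) (g (x0, 0)) < 1"
    using g[unfolded continuous_on_iff, rule_format, of "(x0, 0)" 1] U e0 by auto
  define d where "d = Min {r, e0, s / 2}"
  have d: "0 < d" "d \<le> r" "d \<le> e0" "d \<le> s / 2"
    unfolding d_def using r s e0 by auto
  have bound: "norm (g (x, e)) \<le> norm (g (x0, 0)) + 1" if "x \<in> ball x0 d" "e \<in> {0..<d}" for x e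
  proof -
    have "dist (x, e) (x0, 0) \<le> dist x x0 + dist e 0"
      unfolding dist_Pair_Pair by (rule sqrt_sum_squares_le_sum) simp_all
    also have "\<dots> < s"
      using that d by (auto simp: dist_commute)
    finally have "dist (x, e) (x0, 0) < s" .
    moreover have "(x, e) \<in> U \<times> {0..<e0}"
      using that d r by (auto simp: subset_iff)
    ultimately have "dist (g (x, e)) (g (x0, 0)) < 1"
      using s by blast
    then show ?thesis
      using norm_triangle_ineq2[of "g (x, e)" "g (x0, 0)"] by (simp add: dist_norm)
  qed
  have sub: "ball x0 d \<subseteq> U"
    using r d by (auto simp: subset_iff)
  show ?thesis
    by (rule that[of "norm (g (x0, 0)) + 1" d]) (use bound d sub in auto)
qed

text \<open>
  Pointwise information about a derivative, namely its values on the finitely many basis vectors,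
  thereby controls it on all vectors at once, including vectors that vary with the parameter.
\<close>

lemma linear_expand_Basis:
  fixes L :: "'a::euclidean_space \<Rightarrow> 'b::real_normed_vector"
  assumes "linear L"
  shows "L u = (\<Sum>b\<in>Basis. (u \<bullet> b) *\<^sub>R L b)"
proof -
  have "L u = L (\<Sum>b\<in>Basis. (u \<bullet> b) *\<^sub>R b)"
    by (simp add: euclidean_representation)
  then show ?thesis
    using assms by (simp add: linear_sum linear_scale)
qed

lemma linear_bound_Basis:
  fixes L :: "'a::euclidean_space \<Rightarrow> 'b::real_normed_vector"
  assumes "linear L"
  shows "norm (L u) \<le> (\<Sum>b\<in>Basis. norm (L b)) * norm u"
proof -
  have "L u = (\<Sum>b\<in>Basis. (u \<bullet> b) *\<^sub>R L b)"
    using assms by (rule linear_expand_Basis)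
  also have "norm \<dots> \<le> (\<Sum>b\<in>Basis. norm (L b) * norm u)"
    by (rule sum_norm_le) (simp add: Basis_le_norm mult.commute[of "norm (L _)"] mult_right_mono)
  finally show ?thesis
    by (simp add: sum_distrib_right)
qed

lemma tendsto_linear_family:
  fixes L :: "'c \<Rightarrow> 'a::euclidean_space \<Rightarrow> 'b::real_normed_vector"
  assumes lin: "\<forall>\<^sub>F e in G. linear (L e)" "linear L0"
    and L: "\<And>b. b \<in> Basis \<Longrightarrow> ((\<lambda>e. L e b) \<longlongrightarrow> L0 b) G"
    and u: "(u \<longlongrightarrow> u0) G"
  shows "((\<lambda>e. L e (u e)) \<longlongrightarrow> L0 u0) G"
proof -
  have "((\<lambda>e. \<Sum>b\<in>Basis. (u e \<bullet> b) *\<^sub>R L e b) \<longlongrightarrow> (\<Sum>b\<in>Basis. (u0 \<bullet> b) *\<^sub>R L0 b)) G"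
    by (intro tendsto_intros L u)
  moreover have "\<forall>\<^sub>F e in G. (\<Sum>b\<in>Basis. (u e \<bullet> b) *\<^sub>R L e b) = L e (u e)"
    using lin(1) by eventually_elim (use linear_expand_Basis in metis)
  ultimately show ?thesis
    unfolding linear_expand_Basis[OF lin(2), of u0] by (rule Lim_transform_eventually)
qed

text \<open>
  By the mean value inequality in the parameter, since the partial derivative with respect to the
  parameter is continuous and hence bounded near \<open>(x0, 0)\<close>.
\<close>

lemma parameter_Lipschitz:
  fixes Y :: "'a::real_normed_vector \<times> real \<Rightarrow> 'b::real_normed_vector"
  assumes Y: "Ck_on (Suc k) (U \<times> {0..<e0}) Y" and U: "open U" "x0 \<in> U" and e0: "e0 > 0"
  obtains C d where "C \<ge> 0" "0 < d" "d \<le> e0" "ball x0 d \<subseteq> U"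
    and "\<And>x e. x \<in> ball x0 d \<Longrightarrow> e \<in> {0..<d} \<Longrightarrow> norm (Y (x, e) - Y (x, 0)) \<le> C * e"
proof -
  obtain Y' where Y': "\<And>z. z \<in> U \<times> {0..<e0} \<Longrightarrow> (Y has_derivative Y' z) (at z within U \<times> {0..<e0})"
    and cont: "\<And>v. continuous_on (U \<times> {0..<e0}) (\<lambda>z. Y' z v)"
    using Y by (rule Ck_on_SucE) blast
  obtain C d where C: "C \<ge> 0" "0 < d" "d \<le> e0" "ball x0 d \<subseteq> U"
    and bound: "\<And>x e. x \<in> ball x0 d \<Longrightarrow> e \<in> {0..<d} \<Longrightarrow> norm (Y' (x, e) (0, 1)) \<le> C"
    by (rule continuous_on_imp_locally_bounded[OF cont[of "(0, 1)"] U e0]) (rule that)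
  have "norm (Y (x, e) - Y (x, 0)) \<le> C * e" if x: "x \<in> ball x0 d" and e: "e \<in> {0..<d}" for x e
  proof -
    have "norm (Y (x, e) - Y (x, 0)) \<le> C * norm (e - 0)"
    proof (rule differentiable_bound[where S = "{0..<d}" and f = "\<lambda>s. Y (x, s)"
          and f' = "\<lambda>s h. h *\<^sub>R Y' (x, s) (0, 1)"])
      fix s assume s: "s \<in> {0..<d}"
      have "((\<lambda>s. Y (x, s)) has_derivative (\<lambda>h. h *\<^sub>R Y' (x, s) (0, 1))) (at s within {0..<e0})"
        using x s C by (intro has_derivative_snd_slice[where U = U] Y') auto
      then show "((\<lambda>s. Y (x, s)) has_derivative (\<lambda>h. h *\<^sub>R Y' (x, s) (0, 1))) (at s within {0..<d})"
        by (rule has_derivative_subset) (use C in auto)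
      show "onorm (\<lambda>h. h *\<^sub>R Y' (x, s) (0, 1)) \<le> C"
      proof (rule onorm_bound)
        show "norm (h *\<^sub>R Y' (x, s) (0, 1)) \<le> C * norm h" for h
          using mult_right_mono[OF bound[OF x s], of "\<bar>h\<bar>"] by (simp add: mult.commute)
      qed (use C in simp)
    qed (use e in auto)
    then show ?thesis
      using e by simp
  qed
  with C show ?thesis
    by (rule that)
qed

text \<open>
  The partial derivatives along the basis vectors are continuous in the point and the parameter
  together, so one constant serves for all nearby points and all small parameters.
\<close>

lemma frechet_derivative_fst_slice_bounded:
  fixes f :: "'a::euclidean_space \<times> real \<Rightarrow> 'b::real_normed_vector"
  assumes f: "Ck_on (Suc k) (U \<times> {0..<e0}) f" and U: "open U" "x0 \<in> U" and e0: "e0 > 0"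
  obtains C d where "C \<ge> 0" "0 < d" "d \<le> e0" "ball x0 d \<subseteq> U"
    and "\<And>x e u. x \<in> ball x0 d \<Longrightarrow> e \<in> {0..<d} \<Longrightarrow>
      norm (frechet_derivative (\<lambda>x. f (x, e)) (at x) u) \<le> C * norm u"
proof -
  obtain f' where f': "\<And>z. z \<in> U \<times> {0..<e0} \<Longrightarrow> (f has_derivative f' z) (at z within U \<times> {0..<e0})"
    and cont: "\<And>v. continuous_on (U \<times> {0..<e0}) (\<lambda>z. f' z v)"
    using f by (rule Ck_on_SucE) blast
  have "continuous_on (U \<times> {0..<e0}) (\<lambda>z. \<Sum>b\<in>Basis. norm (f' z (b, 0)))"
    by (intro continuous_intros cont)
  then obtain C d where C: "C \<ge> 0" "0 < d" "d \<le> e0" "ball x0 d \<subseteq> U"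
    and bound: "\<And>x e. x \<in> ball x0 d \<Longrightarrow> e \<in> {0..<d} \<Longrightarrow>
      norm (\<Sum>b\<in>Basis. norm (f' (x, e) (b, 0))) \<le> C"
    by (rule continuous_on_imp_locally_bounded[OF _ U e0]) (rule that)
  have "norm (frechet_derivative (\<lambda>x. f (x, e)) (at x) u) \<le> C * norm u"
    if x: "x \<in> ball x0 d" and e: "e \<in> {0..<d}" for x e u
  proof -
    have D: "((\<lambda>x. f (x, e)) has_derivative (\<lambda>h. f' (x, e) (h, 0))) (at x)"
      using x e C U by (intro has_derivative_fst_slice[where U = U and I = "{0..<e0}"] f') auto
    have "norm (f' (x, e) (u, 0)) \<le> (\<Sum>b\<in>Basis. norm (f' (x, e) (b, 0))) * norm u"
      using has_derivative_linear[OF D] by (rule linear_bound_Basis)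
    also have "\<dots> \<le> C * norm u"
      using bound[OF x e] by (intro mult_right_mono) auto
    finally show ?thesis
      using frechet_derivative_at[OF D] by metis
  qed
  with C show ?thesis
    by (rule that)
qed

lemma frechet_derivative_fst_slice_tendsto:
  fixes f :: "'a::euclidean_space \<times> real \<Rightarrow> 'b::real_normed_vector"
  assumes f: "Ck_on (Suc k) (U \<times> {0..<e0}) f" and U: "open U" "x \<in> U" and e0: "e0 > 0"
    and u: "(u \<longlongrightarrow> u0) (at_right 0)"
  shows "((\<lambda>e. frechet_derivative (\<lambda>x. f (x, e)) (at x) (u e)) \<longlongrightarrow>
    frechet_derivative (\<lambda>x. f (x, 0)) (at x) u0) (at_right 0)"
proof -
  obtain f' where f': "\<And>z. z \<in> U \<times> {0..<e0} \<Longrightarrow> (f has_derivative f' z) (at z within U \<times> {0..<e0})"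
    and cont: "\<And>v. continuous_on (U \<times> {0..<e0}) (\<lambda>z. f' z v)"
    using f by (rule Ck_on_SucE) blast
  have D: "((\<lambda>x. f (x, e)) has_derivative (\<lambda>h. f' (x, e) (h, 0))) (at x)" if "e \<in> {0..<e0}" for e
    using that U by (intro has_derivative_fst_slice[where U = U and I = "{0..<e0}"] f') auto
  have fr: "frechet_derivative (\<lambda>x. f (x, e)) (at x) = (\<lambda>h. f' (x, e) (h, 0))"
    if "e \<in> {0..<e0}" for e
    using frechet_derivative_at[OF D[OF that]] by simp
  have ev: "\<forall>\<^sub>F e in at_right 0. e \<in> {0..<e0}"
    using eventually_at_right_real[OF e0] by eventually_elim auto
  have "((\<lambda>e. f' (x, e) (u e, 0)) \<longlongrightarrow> f' (x, 0) (u0, 0)) (at_right 0)"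
  proof (rule tendsto_linear_family[where L = "\<lambda>e h. f' (x, e) (h, 0)"
        and ?L0.0 = "\<lambda>h. f' (x, 0) (h, 0)"])
    show "\<forall>\<^sub>F e in at_right 0. linear (\<lambda>h. f' (x, e) (h, 0))"
      using ev by (auto elim!: eventually_mono intro: has_derivative_linear[OF D])
    show "linear (\<lambda>h. f' (x, 0) (h, 0))"
      by (rule has_derivative_linear[OF D]) (use e0 in simp)
    show "((\<lambda>e. f' (x, e) (b, 0)) \<longlongrightarrow> f' (x, 0) (b, 0)) (at_right 0)" for b
    proof -
      have "continuous_on {0..<e0} (\<lambda>e. f' (x, e) (b, 0))"
        by (rule continuous_on_compose2[OF cont[of "(b, 0)"]]) (use U in \<open>auto intro!: continuous_intros\<close>)
      then have "((\<lambda>e. f' (x, e) (b, 0)) \<longlongrightarrow> f' (x, 0) (b, 0)) (at 0 within {0..<e0})"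
        using e0 by (simp add: continuous_on)
      moreover have "at 0 within {0..<e0} = at_right 0"
        using e0 by (rule at_within_Ico_at_right)
      ultimately show ?thesis
        by simp
    qed
  qed (fact u)
  moreover have "\<forall>\<^sub>F e in at_right 0. f' (x, e) (u e, 0) = frechet_derivative (\<lambda>x. f (x, e)) (at x) (u e)"
    using ev by (auto elim!: eventually_mono simp: fr)
  ultimately show ?thesis
    using e0 by (auto simp: fr intro: Lim_transform_eventually)
qed

section \<open>First-order expansions\<close>

lemma first_order_expansion_quotient:
  assumes ex: "first_order_expansion M A X X0 X1" and p: "p \<in> topspace M" "c \<in> charts_at A p"
  shows "((\<lambda>e. (X e p c - X0 p c) /\<^sub>R e) \<longlongrightarrow> X1 p c) (at_right 0)"
proof -
  have O: "(\<lambda>e. norm (X e p c - (X0 p c + e *\<^sub>R X1 p c))) \<in> O[at_right 0](\<lambda>e. e\<^sup>2)"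
    using ex p by (simp add: first_order_expansion_def)
  obtain K where K: "K > 0"
    and ev: "\<forall>\<^sub>F e in at_right 0. norm (norm (X e p c - (X0 p c + e *\<^sub>R X1 p c))) \<le> K * norm (e\<^sup>2)"
    using landau_o.bigE[OF O] by blast
  have lim: "((\<lambda>e. K * e) \<longlongrightarrow> 0) (at_right (0::real))"
    by (auto intro!: tendsto_eq_intros)
  have "((\<lambda>e. (X e p c - X0 p c) /\<^sub>R e - X1 p c) \<longlongrightarrow> 0) (at_right 0)"
  proof (rule Lim_null_comparison[OF _ lim])
    show "\<forall>\<^sub>F e in at_right 0. norm ((X e p c - X0 p c) /\<^sub>R e - X1 p c) \<le> K * e"
      using ev eventually_at_right_less[of 0]
    proof eventually_elim
      case (elim e)
      have "(X e p c - X0 p c) /\<^sub>R e - X1 p c = (X e p c - (X0 p c + e *\<^sub>R X1 p c)) /\<^sub>R e"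
        using elim(2) by (simp add: algebra_simps)
      then have "norm ((X e p c - X0 p c) /\<^sub>R e - X1 p c) = norm (X e p c - (X0 p c + e *\<^sub>R X1 p c)) / e"
        using elim(2) by (simp add: divide_inverse_commute)
      also have "\<dots> \<le> K * e"
        using elim by (simp add: divide_le_eq power2_eq_square mult.assoc)
      finally show ?case .
    qed
  qed
  then show ?thesis
    using Lim_null by blast
qed

text \<open>
  At parameter \<open>0\<close> the expansion itself says nothing, because it concerns the right-hand
  filter only; the continuity of the family in the parameter supplies the value there.
\<close>

lemma first_order_expansion_at_0:
  assumes at: "Ck_atlas k M A" and X: "Ck_vector_field_family l M A {0..<e0} X" and e0: "e0 > 0"
    and ex: "first_order_expansion M A X X0 X1" and p: "p \<in> topspace M" "c \<in> charts_at A p"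
  shows "X 0 p c = X0 p c"
proof -
  have c: "c \<in> A" "p \<in> chart_dom c" "is_chart M c"
    using p at by (auto simp: charts_at_def Ck_atlas_def)
  have "continuous_on ((chart_map c ` chart_dom c) \<times> {0..<e0}) (\<lambda>(x, e). X e (chart_inv c x) c)"
    using X c Ck_on_imp_continuous_on unfolding Ck_vector_field_family_def by blast
  then have "continuous_on {0..<e0} (\<lambda>e. case (chart_map c p, e) of (x, e) \<Rightarrow> X e (chart_inv c x) c)"
    by (rule continuous_on_compose2) (use c in \<open>auto intro!: continuous_intros\<close>)
  then have "((\<lambda>e. X e p c) \<longlongrightarrow> X 0 p c) (at 0 within {0..<e0})"
    using e0 by (simp add: continuous_on chart_inv_map[OF c(3,2)])
  then have lim: "((\<lambda>e. X e p c) \<longlongrightarrow> X 0 p c) (at_right 0)"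
    using at_within_Ico_at_right[OF e0] by simp
  have "((\<lambda>e. X0 p c + e *\<^sub>R ((X e p c - X0 p c) /\<^sub>R e)) \<longlongrightarrow> X0 p c + 0 *\<^sub>R X1 p c) (at_right 0)"
    by (intro tendsto_intros first_order_expansion_quotient[OF ex p])
  moreover have "\<forall>\<^sub>F e in at_right 0. X0 p c + e *\<^sub>R ((X e p c - X0 p c) /\<^sub>R e) = X e p c"
    using eventually_at_right_less[of "0::real"] by eventually_elim simp
  ultimately have "((\<lambda>e. X e p c) \<longlongrightarrow> X0 p c) (at_right 0)"
    using Lim_transform_eventually by fastforce
  then show ?thesis
    using lim tendsto_unique trivial_limit_at_right_real by blast
qed

section \<open>Differentials and integral curves\<close>

text \<open>
  The chart that \<^const>\<open>differential\<close> chooses depends on the point alone, so the differentials of both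
  functions are computed in the same chart, where the functions agree near the point.
\<close>

lemma differential_cong:
  assumes at: "Ck_atlas k M A" and V: "openin M V" "p \<in> V" and F: "Ck_function (Suc l) A V F"
    and W: "openin M W" "p \<in> W" and eq: "\<And>q. q \<in> W \<Longrightarrow> F q = G q"
  shows "differential A F p v = differential A G p v"
proof -
  define c where "c = (SOME c. c \<in> charts_at A p)"
  have "\<exists>c. c \<in> charts_at A p"
    using W openin_subset at unfolding Ck_atlas_def charts_at_def by blast
  then have "c \<in> charts_at A p"
    unfolding c_def by (rule someI_ex)
  then have c: "c \<in> A" "p \<in> chart_dom c" and ch: "is_chart M c"
    using at by (auto simp: Ck_atlas_def charts_at_def)
  let ?U = "chart_map c ` (chart_dom c \<inter> W)" and ?x = "chart_map c p"
  have U: "open ?U" "?x \<in> ?U"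
    using open_chart_image[OF ch W(1)] c W by auto
  have "(F \<circ> chart_inv c) differentiable at ?x"
  proof (rule Ck_on_Suc_differentiable)
    show "Ck_on (Suc l) (chart_map c ` (chart_dom c \<inter> V)) (F \<circ> chart_inv c)"
      using F c by (simp only: Ck_function_def)
    show "open (chart_map c ` (chart_dom c \<inter> V))"
      by (rule open_chart_image[OF ch V(1)])
  qed (use c V in blast)
  then have "(F \<circ> chart_inv c has_derivative frechet_derivative (F \<circ> chart_inv c) (at ?x)) (at ?x)"
    by (simp only: frechet_derivative_works)
  then have "(G \<circ> chart_inv c has_derivative frechet_derivative (F \<circ> chart_inv c) (at ?x)) (at ?x)"
    by (rule has_derivative_transform_within_open[OF _ U]) (auto simp: chart_inv_map[OF ch] eq)
  then have "frechet_derivative (F \<circ> chart_inv c) (at ?x) = frechet_derivative (G \<circ> chart_inv c) (at ?x)"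
    by (rule frechet_derivative_at)
  then show ?thesis
    by (simp only: differential_def Let_def c_def[symmetric])
qed

lemma integral_curve_has_vector_derivative:
  assumes at: "Ck_atlas (Suc k) M A" and X: "vector_field M A X" and \<gamma>: "integral_curve M A X \<gamma>"
    and W: "openin M W" "\<gamma> t \<in> W" and F: "Ck_function (Suc l) A W F"
  shows "((\<lambda>s. F (\<gamma> s)) has_vector_derivative differential A F (\<gamma> t) (X (\<gamma> t))) (at t)"
proof -
  have top: "\<gamma> t \<in> topspace M"
    using W openin_subset by blast
  then obtain c where c: "c \<in> A" "\<gamma> t \<in> chart_dom c"
    using at unfolding Ck_atlas_def by blast
  then have ch: "is_chart M c" and cat: "c \<in> charts_at A (\<gamma> t)"
    using at by (auto simp: Ck_atlas_def charts_at_def)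
  have op: "openin M (chart_dom c)"
    using ch by (simp only: is_chart_def)
  let ?D = "frechet_derivative (F \<circ> chart_inv c) (at (chart_map c (\<gamma> t)))"
  have "(F \<circ> chart_inv c) differentiable at (chart_map c (\<gamma> t))"
  proof (rule Ck_on_Suc_differentiable)
    show "Ck_on (Suc l) (chart_map c ` (chart_dom c \<inter> W)) (F \<circ> chart_inv c)"
      using F c by (simp only: Ck_function_def)
    show "open (chart_map c ` (chart_dom c \<inter> W))"
      by (rule open_chart_image[OF ch W(1)])
  qed (use c W in blast)
  then have DF: "((F \<circ> chart_inv c) has_derivative ?D) (at ((chart_map c \<circ> \<gamma>) t))"
    using frechet_derivative_works by auto
  have D\<gamma>: "((chart_map c \<circ> \<gamma>) has_vector_derivative X (\<gamma> t) c) (at t)"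
    using \<gamma> cat unfolding integral_curve_def by blast
  have "((F \<circ> chart_inv c) \<circ> (chart_map c \<circ> \<gamma>) has_vector_derivative ?D (X (\<gamma> t) c)) (at t)"
    using vector_derivative_diff_chain_within[OF D\<gamma>, of _ ?D] DF
    using has_derivative_at_withinI by blast
  moreover have "?D (X (\<gamma> t) c) = differential A F (\<gamma> t) (X (\<gamma> t))"
    using differential_chart[OF at W(1) F W(2) _ cat] X top unfolding vector_field_def by simp
  ultimately have D: "((F \<circ> chart_inv c) \<circ> (chart_map c \<circ> \<gamma>) has_vector_derivative
      differential A F (\<gamma> t) (X (\<gamma> t))) (at t)"
    by simp
  have "openin euclideanreal {s \<in> topspace euclideanreal. \<gamma> s \<in> chart_dom c}"
    using \<gamma> op unfolding integral_curve_def by (blast intro: openin_continuous_map_preimage)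
  then have "open {s. \<gamma> s \<in> chart_dom c}"
    by simp
  then show ?thesis
    by (rule has_vector_derivative_transform_within_open[OF D])
      (use c in \<open>auto simp: chart_inv_map[OF ch]\<close>)
qed

section \<open>A family of first integrals along the unperturbed field\<close>

text \<open>
  A first integral \<open>F\<close> of \<open>X\<close> satisfies \<open>dF(X) = 0\<close>, hence \<open>dF(Y) = - dF(X - Y)\<close>.  The right-hand side
  is small when \<open>Y\<close> is close to \<open>X\<close>, which turns exact invariance under the perturbed field into an
  estimate for the change along the unperturbed one.
\<close>

lemma first_integral_differential_difference:
  assumes at: "Ck_atlas (Suc k) M A" and W: "openin M W" and p: "p \<in> W" "c \<in> charts_at A p"
    and X: "vector_field M A X" and Y: "vector_field M A Y" and F: "first_integral (Suc l) A W X F"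
  shows "differential A F p (Y p) =
    - frechet_derivative (F \<circ> chart_inv c) (at (chart_map c p)) (X p c - Y p c)"
proof -
  have top: "p \<in> topspace M"
    using W p openin_subset by blast
  have c: "c \<in> A" "p \<in> chart_dom c" "is_chart M c"
    using p at by (auto simp: charts_at_def Ck_atlas_def)
  have CF: "Ck_function (Suc l) A W F"
    using F by (simp add: first_integral_def)
  have "(F \<circ> chart_inv c) differentiable at (chart_map c p)"
  proof (rule Ck_on_Suc_differentiable)
    show "Ck_on (Suc l) (chart_map c ` (chart_dom c \<inter> W)) (F \<circ> chart_inv c)"
      using CF c by (simp only: Ck_function_def)
    show "open (chart_map c ` (chart_dom c \<inter> W))"
      by (rule open_chart_image[OF c(3) W])
  qed (use c p in blast)
  then have lin: "linear (frechet_derivative (F \<circ> chart_inv c) (at (chart_map c p)))"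
    by (rule linear_frechet_derivative)
  have "frechet_derivative (F \<circ> chart_inv c) (at (chart_map c p)) (X p c) = 0"
    using differential_chart[OF at W CF p(1) _ p(2), of "X p"] X top F p(1)
    by (simp add: vector_field_def first_integral_def)
  moreover have "differential A F p (Y p) =
      frechet_derivative (F \<circ> chart_inv c) (at (chart_map c p)) (Y p c)"
    using differential_chart[OF at W CF p(1) _ p(2), of "Y p"] Y top
    by (simp add: vector_field_def)
  ultimately show ?thesis
    using lin by (simp add: linear_diff)
qed

text \<open>
  The left-hand side equals \<open>dF\<^sub>e(X\<^sub>e - X\<^sub>0)\<close> up to sign.  Near \<open>p\<close> and for small \<open>e\<close> the linear form \<open>dF\<^sub>e\<close>
  has bounded norm in a chart, and the vector \<open>X\<^sub>e - X\<^sub>0\<close> is of order \<open>e\<close>.  The pointwise expansion would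
  give no constant that is uniform in \<open>q\<close>; the joint smoothness of the family does.
\<close>

lemma first_integral_family_locally_linear_bound:
  assumes at: "Ck_atlas (Suc k) M A" and e0: "e0 > 0"
    and X: "Ck_vector_field_family (Suc l) M A {0..<e0} X"
    and W: "openin M W" "p \<in> W"
    and F: "\<And>e. e \<in> {0..<e0} \<Longrightarrow> first_integral (Suc m) A W (X e) (F e)"
    and Ff: "Ck_function_family (Suc j) A W {0..<e0} F"
  obtains N C d where "openin M N" "p \<in> N" "0 < d"
    and "\<And>q e. q \<in> N \<Longrightarrow> e \<in> {0..<d} \<Longrightarrow> \<bar>differential A (F e) q (X 0 q)\<bar> \<le> C * e"
proof -
  obtain c where c: "c \<in> A" "p \<in> chart_dom c"
    using W openin_subset at unfolding Ck_atlas_def by blast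
  then have ch: "is_chart M c"
    using at by (simp add: Ck_atlas_def)
  define U where "U = chart_map c ` (chart_dom c \<inter> W)"
  define f where "f = (\<lambda>(x, e). F e (chart_inv c x))"
  define Y where "Y = (\<lambda>(x, e). X e (chart_inv c x) c)"
  have U: "open U" "chart_map c p \<in> U"
    using open_chart_image[OF ch W(1)] c W by (auto simp: U_def)
  have U': "open (chart_map c ` chart_dom c)" "chart_map c p \<in> chart_map c ` chart_dom c"
    using ch c by (auto simp: is_chart_def)
  have "Ck_on (Suc j) (U \<times> {0..<e0}) f"
    using Ff c unfolding Ck_function_family_def U_def f_def by blast
  then obtain C1 d1 where C1: "C1 \<ge> 0" "0 < d1" "d1 \<le> e0" "ball (chart_map c p) d1 \<subseteq> U"
    and b1: "\<And>x e u. x \<in> ball (chart_map c p) d1 \<Longrightarrow> e \<in> {0..<d1} \<Longrightarrow>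
      norm (frechet_derivative (\<lambda>x. f (x, e)) (at x) u) \<le> C1 * norm u"
    by (rule frechet_derivative_fst_slice_bounded[OF _ U e0]) (rule that)
  have "Ck_on (Suc l) (chart_map c ` chart_dom c \<times> {0..<e0}) Y"
    using X c unfolding Ck_vector_field_family_def Y_def by blast
  then obtain C2 d2 where C2: "C2 \<ge> 0" "0 < d2"
    and b2: "\<And>x e. x \<in> ball (chart_map c p) d2 \<Longrightarrow> e \<in> {0..<d2} \<Longrightarrow>
      norm (Y (x, e) - Y (x, 0)) \<le> C2 * e"
    by (rule parameter_Lipschitz[OF _ U' e0]) (rule that)
  define d where "d = min d1 d2"
  define N where "N = {q \<in> chart_dom c \<inter> W. chart_map c q \<in> ball (chart_map c p) d}"
  have "openin M N"
  proof -
    have op: "openin M (chart_dom c)"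
      using ch by (simp only: is_chart_def)
    have "continuous_map (subtopology M (chart_dom c)) (top_of_set (chart_map c ` chart_dom c)) (chart_map c)"
      using ch by (simp only: is_chart_def homeomorphic_imp_continuous_map)
    then have "continuous_map (subtopology M (chart_dom c)) euclidean (chart_map c)"
      using continuous_map_into_fulltopology by blast
    then have "openin (subtopology M (chart_dom c))
        {q \<in> topspace (subtopology M (chart_dom c)). chart_map c q \<in> ball (chart_map c p) d}"
      by (rule openin_continuous_map_preimage) simp
    then have "openin M {q \<in> topspace (subtopology M (chart_dom c)). chart_map c q \<in> ball (chart_map c p) d}"
      using op openin_trans_full by blast
    then have "openin M ({q \<in> topspace (subtopology M (chart_dom c)). chart_map c q \<in> ball (chart_map c p) d} \<inter> W)"
      using W by blast
    moreover have "N = {q \<in> topspace (subtopology M (chart_dom c)). chart_map c q \<in> ball (chart_map c p) d} \<inter> W"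
      using openin_subset[OF op] by (auto simp: N_def)
    ultimately show ?thesis
      by simp
  qed
  moreover have "p \<in> N"
    using c W C1 C2 by (auto simp: N_def d_def)
  moreover have "0 < d"
    using C1 C2 by (simp add: d_def)
  moreover have "\<bar>differential A (F e) q (X 0 q)\<bar> \<le> (C1 * C2) * e" if q: "q \<in> N" and e: "e \<in> {0..<d}" for q e
  proof -
    have x: "chart_map c q \<in> ball (chart_map c p) d1" "chart_map c q \<in> ball (chart_map c p) d2"
      and e': "e \<in> {0..<d1}" "e \<in> {0..<d2}" "e \<in> {0..<e0}" and qc: "q \<in> chart_dom c" "q \<in> W"
      using q e C1 by (auto simp: N_def d_def)
    have "q \<in> W" "c \<in> charts_at A q"
      using qc c by (auto simp: charts_at_def)
    moreover have "vector_field M A (X e)" "vector_field M A (X 0)"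
      using X e' e0 by (auto simp: Ck_vector_field_family_def)
    ultimately have "differential A (F e) q (X 0 q) =
        - frechet_derivative (F e \<circ> chart_inv c) (at (chart_map c q)) (X e q c - X 0 q c)"
      using first_integral_differential_difference[OF at W(1)] F[OF e'(3)] by blast
    also have "\<dots> = - frechet_derivative (\<lambda>x. f (x, e)) (at (chart_map c q))
        (Y (chart_map c q, e) - Y (chart_map c q, 0))"
      by (simp add: f_def Y_def chart_inv_map[OF ch qc(1)] o_def)
    finally have "\<bar>differential A (F e) q (X 0 q)\<bar> \<le>
        C1 * norm (Y (chart_map c q, e) - Y (chart_map c q, 0))"
      using b1[OF x(1) e'(1)] by simp
    also have "\<dots> \<le> C1 * (C2 * e)"
      using b2[OF x(2) e'(2)] C1(1) by (rule mult_left_mono)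
    finally show ?thesis
      by (simp add: mult.assoc)
  qed
  ultimately show ?thesis
    by (rule that)
qed

text \<open>
  The quotient is \<open>- dF\<^sub>e((X\<^sub>e - X\<^sub>0) / e)\<close>, in which the linear form tends to \<open>dF\<^sub>0\<close> and the vector
  to \<open>X\<^sub>1\<close>.
\<close>

lemma first_integral_family_quotient:
  assumes at: "Ck_atlas (Suc k) M A" and e0: "e0 > 0"
    and X: "Ck_vector_field_family l M A {0..<e0} X" and X1: "vector_field M A X1"
    and ex: "first_order_expansion M A X (X 0) X1"
    and W: "openin M W" "p \<in> W"
    and F: "\<And>e. e \<in> {0..<e0} \<Longrightarrow> first_integral (Suc m) A W (X e) (F e)"
    and Ff: "Ck_function_family (Suc j) A W {0..<e0} F"
  shows "((\<lambda>e. differential A (F e) p (X 0 p) / e) \<longlongrightarrow> - differential A (F 0) p (X1 p)) (at_right 0)"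
proof -
  have top: "p \<in> topspace M"
    using W openin_subset by blast
  then obtain c where c: "c \<in> A" "p \<in> chart_dom c"
    using at unfolding Ck_atlas_def by blast
  then have ch: "is_chart M c" and cat: "c \<in> charts_at A p"
    using at by (auto simp: Ck_atlas_def charts_at_def)
  define U where "U = chart_map c ` (chart_dom c \<inter> W)"
  define f where "f = (\<lambda>(x, e). F e (chart_inv c x))"
  define D where "D = (\<lambda>e. frechet_derivative (\<lambda>x. f (x, e)) (at (chart_map c p)))"
  have fD: "frechet_derivative (F e \<circ> chart_inv c) (at (chart_map c p)) = D e" for e
    by (simp add: D_def f_def o_def)
  have U: "open U" "chart_map c p \<in> U"
    using open_chart_image[OF ch W(1)] c W by (auto simp: U_def)
  have "Ck_on (Suc j) (U \<times> {0..<e0}) f"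
    using Ff c unfolding Ck_function_family_def U_def f_def by blast
  then have "((\<lambda>e. D e ((X e p c - X 0 p c) /\<^sub>R e)) \<longlongrightarrow> D 0 (X1 p c)) (at_right 0)"
    unfolding D_def
    by (rule frechet_derivative_fst_slice_tendsto[OF _ U e0 first_order_expansion_quotient[OF ex top cat]])
  then have "((\<lambda>e. - D e ((X e p c - X 0 p c) /\<^sub>R e)) \<longlongrightarrow> - D 0 (X1 p c)) (at_right 0)"
    by (rule tendsto_minus)
  moreover have "\<forall>\<^sub>F e in at_right 0. - D e ((X e p c - X 0 p c) /\<^sub>R e) = differential A (F e) p (X 0 p) / e"
    using eventually_at_right_real[OF e0]
  proof eventually_elim
    case (elim e)
    then have e: "e \<in> {0..<e0}"
      by auto
    have "vector_field M A (X e)" "vector_field M A (X 0)"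
      using X e e0 by (auto simp: Ck_vector_field_family_def)
    then have "differential A (F e) p (X 0 p) = - D e (X e p c - X 0 p c)"
      using first_integral_differential_difference[OF at W cat _ _ F[OF e]] fD by simp
    moreover have "linear (D e)"
      unfolding fD[symmetric]
    proof (intro linear_frechet_derivative Ck_on_Suc_differentiable[OF _ U])
      show "Ck_on (Suc m) U (F e \<circ> chart_inv c)"
        using F[OF e] c by (simp only: first_integral_def Ck_function_def U_def)
    qed
    ultimately show ?case
      by (simp add: linear_scale divide_inverse_commute)
  qed
  moreover have "differential A (F 0) p (X1 p) = D 0 (X1 p c)"
    using differential_chart[OF at W(1) _ W(2) _ cat, of m "F 0" "X1 p"] F[of 0] e0 X1 top fD
    by (simp add: first_integral_def vector_field_def)
  ultimately show ?thesis
    using Lim_transform_eventually by fastforce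
qed

text \<open>
  This passes from the neighbourhoods of single points, each inside one chart, to the whole orbit,
  which need not lie in one chart.
\<close>

lemma compact_uniform_parameter_bound:
  fixes \<gamma> :: "real \<Rightarrow> 'm" and g :: "real \<Rightarrow> 'm \<Rightarrow> real"
  assumes K: "compact K" and \<gamma>: "continuous_map euclideanreal M \<gamma>"
    and loc: "\<And>t. t \<in> K \<Longrightarrow> \<exists>N C d. openin M N \<and> \<gamma> t \<in> N \<and> 0 < d \<and>
      (\<forall>q\<in>N. \<forall>e\<in>{0..<d}. \<bar>g e q\<bar> \<le> C * e)"
  obtains C d where "0 < d" "\<And>t e. t \<in> K \<Longrightarrow> e \<in> {0..<d} \<Longrightarrow> \<bar>g e (\<gamma> t)\<bar> \<le> C * e"
proof -
  obtain N C d where N: "\<And>t. t \<in> K \<Longrightarrow> openin M (N t)" "\<And>t. t \<in> K \<Longrightarrow> \<gamma> t \<in> N t"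
    "\<And>t. t \<in> K \<Longrightarrow> 0 < d t"
    "\<And>t q e. t \<in> K \<Longrightarrow> q \<in> N t \<Longrightarrow> e \<in> {0..<d t} \<Longrightarrow> \<bar>g e q\<bar> \<le> C t * e"
    using loc by metis
  have op: "open {s. \<gamma> s \<in> N t}" if "t \<in> K" for t
    using openin_continuous_map_preimage[OF \<gamma> N(1)[OF that]] by simp
  obtain J where J: "J \<subseteq> K" "finite J" "K \<subseteq> (\<Union>t\<in>J. {s. \<gamma> s \<in> N t})"
    by (rule compactE_image[OF K, of K "\<lambda>t. {s. \<gamma> s \<in> N t}"]) (use op N(2) in auto)
  define d' where "d' = Min (insert 1 (d ` J))"
  define C' where "C' = Max (insert 0 (C ` J))"
  have "0 < d'"
    unfolding d'_def using J N(3) by (auto simp: subset_iff)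
  moreover have "\<bar>g e (\<gamma> s)\<bar> \<le> C' * e" if s: "s \<in> K" and e: "e \<in> {0..<d'}" for s e
  proof -
    obtain t where t: "t \<in> J" "\<gamma> s \<in> N t"
      using J s by auto
    have "d' \<le> d t" "C t \<le> C'"
      unfolding d'_def C'_def using J t by auto
    then have "\<bar>g e (\<gamma> s)\<bar> \<le> C t * e"
      using N(4)[of t "\<gamma> s" e] J t e by auto
    also have "\<dots> \<le> C' * e"
      using \<open>C t \<le> C'\<close> e by (intro mult_right_mono) auto
    finally show ?thesis .
  qed
  ultimately show ?thesis
    by (rule that)
qed

theorem theorem2p2:
  fixes M :: "'m topology"
    and A :: "('m, 'n::finite) chart set"
    and X :: "real \<Rightarrow> 'm \<Rightarrow> ('m, 'n) tangent"
    and X0 X1 :: "'m \<Rightarrow> ('m, 'n) tangent"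
    and \<gamma> :: "real \<Rightarrow> 'm"
    and F :: "'m \<Rightarrow> real"
    and F\<epsilon> :: "real \<Rightarrow> 'm \<Rightarrow> real"
    and V W :: "'m set"
    and T \<epsilon>0 :: real
  assumes "CARD('n) \<ge> 2"
    and "oriented_Ck_manifold 3 M A"
    and "\<epsilon>0 > 0"
    and "Ck_vector_field_family 2 M A {0..<\<epsilon>0} X"
    and "vector_field M A X0"
    and "vector_field M A X1"
    and "first_order_expansion M A X X0 X1"
    and "T > 0"
    and "integral_curve M A X0 \<gamma>"
    and "\<And>t. \<gamma> (t + T) = \<gamma> t"
    and "openin M V" and "\<gamma> ` {0..<T} \<subseteq> V"
    and "first_integral 3 A V X0 F"
    and "\<not> F constant_on V"
    and "openin M W" and "\<gamma> ` {0..<T} \<subseteq> W"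
    and "\<And>\<epsilon>. \<epsilon> \<in> {0..<\<epsilon>0} \<Longrightarrow> first_integral 3 A W (X \<epsilon>) (F\<epsilon> \<epsilon>)"
    and "Ck_function_family 2 A W {0..<\<epsilon>0} F\<epsilon>"
    and "\<And>p. p \<in> V \<inter> W \<Longrightarrow> F\<epsilon> 0 p = F p"
  shows "((\<lambda>t. differential A F (\<gamma> t) (X1 (\<gamma> t))) has_integral 0) {0..T}"
proof -
  have at: "Ck_atlas (Suc 2) M A"
    using assms(2) by (simp add: oriented_Ck_manifold_def numeral_3_eq_3 numeral_2_eq_2)
  have X: "Ck_vector_field_family (Suc 1) M A {0..<\<epsilon>0} X"
    using assms(4) by (simp add: numeral_2_eq_2)
  have Ff: "Ck_function_family (Suc 1) A W {0..<\<epsilon>0} F\<epsilon>"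
    using assms(18) by (simp add: numeral_2_eq_2)
  have FI: "first_integral (Suc 2) A W (X e) (F\<epsilon> e)" if "e \<in> {0..<\<epsilon>0}" for e
    using assms(17)[OF that] by (simp add: numeral_3_eq_3 numeral_2_eq_2)
  have vf: "vector_field M A (X e)" if "e \<in> {0..<\<epsilon>0}" for e
    using X that by (simp add: Ck_vector_field_family_def)
  note e0 = assms(3)
  \<comment> \<open>Outside the charts around a point both sides are zero by the normalisation of tangent vectors.\<close>
  have X0: "X 0 p = X0 p" if "p \<in> topspace M" for p
  proof
    fix c
    show "X 0 p c = X0 p c"
    proof (cases "c \<in> charts_at A p")
      case True
      then show ?thesis
        using first_order_expansion_at_0[OF at assms(4) e0 assms(7) that] by blast
    next
      case False
      moreover have "X 0 p \<in> tangent_space A p" "X0 p \<in> tangent_space A p"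
        using vf[of 0] e0 assms(5) that by (auto simp: vector_field_def)
      ultimately show ?thesis
        unfolding tangent_space_def by (metis (mono_tags, lifting) mem_Collect_eq)
    qed
  qed
  have ex: "first_order_expansion M A X (X 0) X1"
    using assms(7) X0 by (simp add: first_order_expansion_def)
  have \<gamma>c: "continuous_map euclideanreal M \<gamma>"
    using assms(9) by (simp add: integral_curve_def)
  have \<gamma>VW: "\<gamma> t \<in> V \<inter> W" if "t \<in> {0..T}" for t
  proof (cases "t = T")
    case True
    then have "\<gamma> t = \<gamma> 0"
      using assms(10)[of 0] by simp
    then show ?thesis
      using assms(8,12,16) by force
  next
    case False
    then show ?thesis
      using that assms(12,16) by force
  qed
  have \<gamma>top: "\<gamma> t \<in> topspace M" if "t \<in> {0..T}" for t
    using \<gamma>VW[OF that] assms(15) openin_subset by blast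
  obtain C d where d: "0 < d"
    and bound: "\<And>t e. t \<in> {0..T} \<Longrightarrow> e \<in> {0..<d} \<Longrightarrow>
      \<bar>differential A (F\<epsilon> e) (\<gamma> t) (X 0 (\<gamma> t))\<bar> \<le> C * e"
  proof (rule compact_uniform_parameter_bound[OF compact_Icc[of 0 T] \<gamma>c,
        of "\<lambda>e q. differential A (F\<epsilon> e) q (X 0 q)"])
    fix t assume "t \<in> {0..T}"
    then have W: "\<gamma> t \<in> W"
      using \<gamma>VW by blast
    show "\<exists>N C d. openin M N \<and> \<gamma> t \<in> N \<and> 0 < d \<and>
        (\<forall>q\<in>N. \<forall>e\<in>{0..<d}. \<bar>differential A (F\<epsilon> e) q (X 0 q)\<bar> \<le> C * e)"
      by (rule first_integral_family_locally_linear_bound[OF at e0 X assms(15) W FI Ff]) blast+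
  qed blast
  \<comment> \<open>Dominated convergence is a statement about sequences, so the parameter runs through one that
    tends to zero inside the range where both the bound and the first integrals are available.\<close>
  define \<delta> where "\<delta> = min d \<epsilon>0"
  define e where "e k = \<delta> / real (Suc (Suc k))" for k
  have \<delta>: "0 < \<delta>"
    using d e0 by (simp add: \<delta>_def)
  have e_range: "0 < e k" "e k < \<delta>" for k
    using \<delta> by (auto simp: e_def field_simps intro: add_pos_nonneg)
  have e_dom: "e k \<in> {0..<\<epsilon>0}" "e k \<in> {0..<d}" for k
    using e_range[of k] by (auto simp: \<delta>_def)
  have "e \<longlonglongrightarrow> 0"
    unfolding e_def
    using LIMSEQ_Suc[OF LIMSEQ_Suc[OF lim_const_over_n[of \<delta>]]] by simp
  then have e_lim: "filterlim e (at_right 0) sequentially"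
    using e_range(1) by (simp add: filterlim_at less_imp_neq[OF e_range(1), symmetric])
  define h where "h k t = differential A (F\<epsilon> (e k)) (\<gamma> t) (X 0 (\<gamma> t)) / e k" for k t
  \<comment> \<open>Periodicity enters here: the first integral has the same value at both ends of the orbit.\<close>
  have h_int: "(h k has_integral 0) {0..T}" for k
  proof -
    have "((\<lambda>t. differential A (F\<epsilon> (e k)) (\<gamma> t) (X0 (\<gamma> t))) has_integral
        (F\<epsilon> (e k) (\<gamma> T) - F\<epsilon> (e k) (\<gamma> 0))) {0..T}"
    proof (rule fundamental_theorem_of_calculus)
      fix t assume t: "t \<in> {0..T}"
      have W: "\<gamma> t \<in> W"
        using \<gamma>VW[OF t] by blast
      have CF: "Ck_function (Suc 2) A W (F\<epsilon> (e k))"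
        using FI[OF e_dom(1)] by (simp add: first_integral_def)
      show "((\<lambda>t. F\<epsilon> (e k) (\<gamma> t)) has_vector_derivative
          differential A (F\<epsilon> (e k)) (\<gamma> t) (X0 (\<gamma> t))) (at t within {0..T})"
        by (rule has_vector_derivative_at_within)
          (rule integral_curve_has_vector_derivative[OF at assms(5,9,15) W CF])
    qed (use assms(8) in simp)
    moreover have "\<gamma> T = \<gamma> 0"
      using assms(10)[of 0] by simp
    ultimately have "((\<lambda>t. differential A (F\<epsilon> (e k)) (\<gamma> t) (X0 (\<gamma> t))) has_integral 0) {0..T}"
      by simp
    from has_integral_divide[OF this, of "e k"]
    have "((\<lambda>t. differential A (F\<epsilon> (e k)) (\<gamma> t) (X0 (\<gamma> t)) / e k) has_integral 0) {0..T}"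
      by simp
    then show ?thesis
      by (rule has_integral_eq[rotated]) (simp add: h_def X0 \<gamma>top)
  qed
  have h_bound: "norm (h k t) \<le> C" if "t \<in> {0..T}" for k t
    using bound[OF that e_dom(2)[of k]] e_range[of k] by (simp add: h_def field_simps)
  have h_lim: "(\<lambda>k. h k t) \<longlonglongrightarrow> - differential A F (\<gamma> t) (X1 (\<gamma> t))" if t: "t \<in> {0..T}" for t
  proof -
    have W: "\<gamma> t \<in> W" and VW: "\<gamma> t \<in> V \<inter> W"
      using \<gamma>VW[OF t] by auto
    have "((\<lambda>e. differential A (F\<epsilon> e) (\<gamma> t) (X 0 (\<gamma> t)) / e) \<longlongrightarrow>
        - differential A (F\<epsilon> 0) (\<gamma> t) (X1 (\<gamma> t))) (at_right 0)"
      by (rule first_integral_family_quotient[OF at e0 X assms(6) ex assms(15) W FI Ff])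
    then have "(\<lambda>k. h k t) \<longlonglongrightarrow> - differential A (F\<epsilon> 0) (\<gamma> t) (X1 (\<gamma> t))"
      unfolding h_def using e_lim by (rule filterlim_compose)
    moreover have "differential A F (\<gamma> t) (X1 (\<gamma> t)) = differential A (F\<epsilon> 0) (\<gamma> t) (X1 (\<gamma> t))"
    proof (rule differential_cong[OF at assms(11) _ _ openin_Int[OF assms(11,15)] VW])
      show "Ck_function (Suc 2) A V F"
        using assms(13) by (simp add: first_integral_def numeral_3_eq_3 numeral_2_eq_2)
    qed (use VW assms(19) in auto)
    ultimately show ?thesis
      by simp
  qed
  have "(\<lambda>t. - differential A F (\<gamma> t) (X1 (\<gamma> t))) integrable_on {0..T}"
    and "(\<lambda>k. integral {0..T} (h k)) \<longlonglongrightarrow> integral {0..T} (\<lambda>t. - differential A F (\<gamma> t) (X1 (\<gamma> t)))"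
    using dominated_convergence[of h "{0..T}" "\<lambda>_. C", OF _ _ h_bound h_lim] h_int
    by (auto simp: has_integral_integrable)
  moreover have "integral {0..T} (h k) = 0" for k
    using h_int by (rule integral_unique)
  ultimately have "((\<lambda>t. - differential A F (\<gamma> t) (X1 (\<gamma> t))) has_integral 0) {0..T}"
    by (simp add: has_integral_integrable_integral LIMSEQ_const_iff)
  from has_integral_neg[OF this] show ?thesis
    by simp
qed

end
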